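(* Consider the problem of minimizing $J(x(\cdot))=\int_{t_0}^{t_1}L(t,x(t),\dot x(t))\,dt$ over $x(\cdot)\in KC^1(I,\mathbb R^n)$ with $x(t_0)=x_0$, $x(t_1)=x_1$. Let $L$ be continuously differentiable in the totality of variables, let the admissible function $\bar x(\cdot)$ be an extremal in this problem, and let $(\bar t_0,\bar t_1)\subset[t_0,t_1]$ be an interval containing no angular point of $\bar x(\cdot)$. For $\eta\in\mathbb R^n$ and $\bar\lambda\in(0,1)$ consider the degeneration condition $$E(\bar L)(t,\eta)=E(\bar L)\big(t,(\bar\lambda-1)^{-1}\bar\lambda\eta\big)=0\quad\text{for all }t\in(\bar t_0,\bar t_1)\qquad(\mathrm D)$$ and the equality $$\bar\lambda\,\Delta\bar L_x^T(t,\eta)\eta+(1-\bar\lambda)\,\Delta\bar L_x^T\big(t,(\bar\lambda-1)^{-1}\bar\lambda\eta\big)\eta=0\quad\text{for all }t\in(\bar t_0,\bar t_1).\qquad(\mathrm C)$$ Then: (i) If $\bar x(\cdot)$ is a strong local minimum in the problem and (D) holds for a vector $\eta\neq0$ and a number $\bar\lambda\in(0,1)$, then (C) holds for these $\eta,\bar\lambda$. (ii) If $\bar x(\cdot)$ is a weak local minimum in the problem, then there exists a number $\delta>0$ such that for every point $\big(\eta,(\bar\lambda-1)^{-1}\bar\lambda\eta,\bar\lambda\big)\in B_\delta(0)\times B_\delta(0)\times(0,1)$ satisfying (D), equality (C) is fulfilled.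
   Context: Setting. $(a,b)\subset\mathbb R$ is an interval, $I:=[t_0,t_1]\subset(a,b)$ with $t_0<t_1$, $x_0,x_1\in\mathbb R^n$, and $L=L(t,x,\dot x):(a,b)\times\mathbb R^n\times\mathbb R^n\to\mathbb R$; $L_x,L_{\dot x}$ are its partial gradients (column vectors) with respect to the second and third arguments; $T$ denotes transposition; $B_\delta(0)$ is the closed ball of radius $\delta$ centered at $0\in\mathbb R^n$. $KC^1(I,\mathbb R^n)$ is the set of piecewise-smooth functions: continuous functions $x:I\to\mathbb R^n$ whose derivative is continuous on $I$ except at finitely many points of $(t_0,t_1)$ (angular points), where $\dot x$ has discontinuities of the first kind (finite one-sided limits); at $t_0$ and $t_1$ the right, respectively left, values of $\dot x$ are finite. A function $x(\cdot)\in KC^1(I,\mathbb R^n)$ with $x(t_0)=x_0$, $x(t_1)=x_1$ is called admissible. An admissible $\bar x(\cdot)$ is an extremal if it satisfies the Euler equation $\frac{d}{dt}L_{\dot x}(t,\bar x(t),\dot{\bar x}(t))=L_x(t,\bar x(t),\dot{\bar x}(t))$ at every $t\in I$ that is not an angular point of $\bar x$ (at $t_0$ and $t_1$ understood one-sidedly). An admissible $\bar x(\cdot)$ is a strong (weak) local minimum if there is $\bar\delta>0$ ($\hat\delta>0$) such that $J(x(\cdot))\ge J(\bar x(\cdot))$ for all admissible $x(\cdot)$ with $\|x(\cdot)-\bar x(\cdot)\|_{C(I,\mathbb R^n)}\le\bar\delta$ (respectively $\max\{\|x(\cdot)-\bar x(\cdot)\|_{C(I,\mathbb R^n)},\|\dot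 x(\cdot)-\dot{\bar x}(\cdot)\|_{L_\infty(I,\mathbb R^n)}\}\le\hat\delta$). Notation along $\bar x(\cdot)$, for $\xi\in\mathbb R^n$: $\bar L(t)=L(t,\bar x(t),\dot{\bar x}(t))$, $\bar L_x(t)=L_x(t,\bar x(t),\dot{\bar x}(t))$, $\bar L_{\dot x}(t)=L_{\dot x}(t,\bar x(t),\dot{\bar x}(t))$, $$E(\bar L)(t,\xi)=L(t,\bar x(t),\dot{\bar x}(t)+\xi)-\bar L(t)-\bar L_{\dot x}^T(t)\xi,\qquad \Delta\bar L_x(t,\xi)=L_x(t,\bar x(t),\dot{\bar x}(t)+\xi)-\bar L_x(t).$$ *)

theory Defs
  imports "HOL-Analysis.Analysis" "HOL-Probability.Essential_Supremum"
begin

definition continuously_differentiable_on ::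
  "('a::real_normed_vector \<Rightarrow> 'b::real_normed_vector) \<Rightarrow> 'a set \<Rightarrow> bool"
  where "continuously_differentiable_on f S \<longleftrightarrow>
    (\<exists>f'. (\<forall>p\<in>S. (f has_derivative blinfun_apply (f' p)) (at p)) \<and> continuous_on S f')"

definition gradient :: "('a::real_inner \<Rightarrow> real) \<Rightarrow> 'a \<Rightarrow> 'a"
  where "gradient f x = (THE D. GDERIV f x :> D)"

type_synonym 'n integrand = "real \<Rightarrow> real^'n \<Rightarrow> real^'n \<Rightarrow> real"

definition L_x :: "'n::finite integrand \<Rightarrow> real \<Rightarrow> real^'n \<Rightarrow> real^'n \<Rightarrow> real^'n"
  where "L_x L t x v = gradient (\<lambda>y. L t y v) x"

definition L_v :: "'n::finite integrand \<Rightarrow> real \<Rightarrow> real^'n \<Rightarrow> real^'n \<Rightarrow> real^'n"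
  where "L_v L t x v = gradient (\<lambda>w. L t x w) v"

text \<open>A function on \<open>I = {t0..t1}\<close> is represented by a total function on the reals; only its values
  on \<open>I\<close> matter below. Derivatives are taken within \<open>I\<close>, hence one-sidedly at \<open>t0\<close> and \<open>t1\<close>. At points
  where the function is not differentiable, \<open>velocity\<close> is an unspecified vector; in a \<open>KC1\<close> function
  there are only finitely many of these.\<close>

definition velocity :: "real \<Rightarrow> real \<Rightarrow> (real \<Rightarrow> real^'n::finite) \<Rightarrow> real \<Rightarrow> real^'n"
  where "velocity t0 t1 x t = vector_derivative x (at t within {t0..t1})"

definition angular_points :: "real \<Rightarrow> real \<Rightarrow> (real \<Rightarrow> real^'n::finite) \<Rightarrow> real set"
  where "angular_points t0 t1 x =
    {t \<in> {t0..t1}. \<not> (x differentiable (at t within {t0..t1}) \<and>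
                      continuous (at t within {t0..t1}) (velocity t0 t1 x))}"

text \<open>Unlike \<^const>\<open>piecewise_C1_differentiable_on\<close>, the following requires finite one-sided limits of
  the derivative. That no endpoint is an angular point says that the one-sided derivative exists
  there and is the one-sided limit of the derivative.\<close>

definition KC1 :: "real \<Rightarrow> real \<Rightarrow> (real \<Rightarrow> real^'n::finite) \<Rightarrow> bool"
  where "KC1 t0 t1 x \<longleftrightarrow>
    continuous_on {t0..t1} x \<and>
    finite (angular_points t0 t1 x) \<and>
    angular_points t0 t1 x \<subseteq> {t0<..<t1} \<and>
    (\<forall>t \<in> angular_points t0 t1 x.
       (\<exists>l. (velocity t0 t1 x \<longlongrightarrow> l) (at_left t)) \<and>
       (\<exists>r. (velocity t0 t1 x \<longlongrightarrow> r) (at_right t)))"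

definition admissible ::
  "real \<Rightarrow> real \<Rightarrow> real^'n::finite \<Rightarrow> real^'n \<Rightarrow> (real \<Rightarrow> real^'n) \<Rightarrow> bool"
  where "admissible t0 t1 x0 x1 x \<longleftrightarrow> KC1 t0 t1 x \<and> x t0 = x0 \<and> x t1 = x1"

definition J :: "'n::finite integrand \<Rightarrow> real \<Rightarrow> real \<Rightarrow> (real \<Rightarrow> real^'n) \<Rightarrow> real"
  where "J L t0 t1 x = integral {t0..t1} (\<lambda>t. L t (x t) (velocity t0 t1 x t))"

definition extremal ::
  "'n::finite integrand \<Rightarrow> real \<Rightarrow> real \<Rightarrow> real^'n \<Rightarrow> real^'n \<Rightarrow> (real \<Rightarrow> real^'n) \<Rightarrow> bool"
  where "extremal L t0 t1 x0 x1 x \<longleftrightarrow>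
    admissible t0 t1 x0 x1 x \<and>
    (\<forall>t \<in> {t0..t1} - angular_points t0 t1 x.
       ((\<lambda>s. L_v L s (x s) (velocity t0 t1 x s))
          has_vector_derivative L_x L t (x t) (velocity t0 t1 x t)) (at t within {t0..t1}))"

definition C_norm :: "real \<Rightarrow> real \<Rightarrow> (real \<Rightarrow> real^'n::finite) \<Rightarrow> ereal"
  where "C_norm t0 t1 f = (SUP t\<in>{t0..t1}. ereal (norm (f t)))"

definition Linf_norm :: "real \<Rightarrow> real \<Rightarrow> (real \<Rightarrow> real^'n::finite) \<Rightarrow> ereal"
  where "Linf_norm t0 t1 f = esssup (lebesgue_on {t0..t1}) (\<lambda>t. ereal (norm (f t)))"

definition strong_local_min ::
  "'n::finite integrand \<Rightarrow> real \<Rightarrow> real \<Rightarrow> real^'n \<Rightarrow> real^'n \<Rightarrow> (real \<Rightarrow> real^'n) \<Rightarrow> bool"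
  where "strong_local_min L t0 t1 x0 x1 xb \<longleftrightarrow>
    admissible t0 t1 x0 x1 xb \<and>
    (\<exists>\<delta>::real. \<delta> > 0 \<and>
      (\<forall>x. admissible t0 t1 x0 x1 x \<and> C_norm t0 t1 (\<lambda>t. x t - xb t) \<le> ereal \<delta>
         \<longrightarrow> J L t0 t1 x \<ge> J L t0 t1 xb))"

definition weak_local_min ::
  "'n::finite integrand \<Rightarrow> real \<Rightarrow> real \<Rightarrow> real^'n \<Rightarrow> real^'n \<Rightarrow> (real \<Rightarrow> real^'n) \<Rightarrow> bool"
  where "weak_local_min L t0 t1 x0 x1 xb \<longleftrightarrow>
    admissible t0 t1 x0 x1 xb \<and>
    (\<exists>\<delta>::real. \<delta> > 0 \<and>
      (\<forall>x. admissible t0 t1 x0 x1 x \<and>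
           max (C_norm t0 t1 (\<lambda>t. x t - xb t))
               (Linf_norm t0 t1 (\<lambda>t. velocity t0 t1 x t - velocity t0 t1 xb t)) \<le> ereal \<delta>
         \<longrightarrow> J L t0 t1 x \<ge> J L t0 t1 xb))"

definition Weierstrass_E ::
  "'n::finite integrand \<Rightarrow> real \<Rightarrow> real \<Rightarrow> (real \<Rightarrow> real^'n) \<Rightarrow> real \<Rightarrow> real^'n \<Rightarrow> real"
  where "Weierstrass_E L t0 t1 xb t \<xi> =
    L t (xb t) (velocity t0 t1 xb t + \<xi>) - L t (xb t) (velocity t0 t1 xb t)
      - L_v L t (xb t) (velocity t0 t1 xb t) \<bullet> \<xi>"

definition Delta_L_x ::
  "'n::finite integrand \<Rightarrow> real \<Rightarrow> real \<Rightarrow> (real \<Rightarrow> real^'n) \<Rightarrow> real \<Rightarrow> real^'n \<Rightarrow> real^'n"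
  where "Delta_L_x L t0 t1 xb t \<xi> =
    L_x L t (xb t) (velocity t0 t1 xb t + \<xi>) - L_x L t (xb t) (velocity t0 t1 xb t)"

definition conj_vec :: "real \<Rightarrow> real^'n::finite \<Rightarrow> real^'n"
  where "conj_vec lam \<eta> = (inverse (lam - 1) * lam) *\<^sub>R \<eta>"

definition degenerate ::
  "'n::finite integrand \<Rightarrow> real \<Rightarrow> real \<Rightarrow> (real \<Rightarrow> real^'n) \<Rightarrow> real \<Rightarrow> real \<Rightarrow> real^'n \<Rightarrow> real \<Rightarrow> bool"
  where "degenerate L t0 t1 xb s0 s1 \<eta> lam \<longleftrightarrow>
    (\<forall>t\<in>{s0<..<s1}. Weierstrass_E L t0 t1 xb t \<eta> = 0 \<and>
                     Weierstrass_E L t0 t1 xb t (conj_vec lam \<eta>) = 0)"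

definition equality_C ::
  "'n::finite integrand \<Rightarrow> real \<Rightarrow> real \<Rightarrow> (real \<Rightarrow> real^'n) \<Rightarrow> real \<Rightarrow> real \<Rightarrow> real^'n \<Rightarrow> real \<Rightarrow> bool"
  where "equality_C L t0 t1 xb s0 s1 \<eta> lam \<longleftrightarrow>
    (\<forall>t\<in>{s0<..<s1}.
       lam * (Delta_L_x L t0 t1 xb t \<eta> \<bullet> \<eta>)
         + (1 - lam) * (Delta_L_x L t0 t1 xb t (conj_vec lam \<eta>) \<bullet> \<eta>) = 0)"

end

theory Submission
  imports Defs
begin

text \<open>
  Given vectors \<open>p\<close>, \<open>q\<close> with \<open>\<alpha> p + \<beta> q = 0\<close> and \<open>\<alpha>, \<beta> > 0\<close>, perturb the extremal by the sawtooth \<open>h\<close> that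
  has slope \<open>p\<close> on \<open>[\<tau>, \<tau> + \<alpha>\<epsilon>]\<close>, slope \<open>q\<close> on \<open>[\<tau> + \<alpha>\<epsilon>, \<tau> + (\<alpha> + \<beta>)\<epsilon>]\<close> and vanishes elsewhere. Where the
  excess function vanishes at \<open>p\<close> and \<open>q\<close>, the increment of the Lagrangian is
  \<open>L_v \<bullet> h' + L_x(t, xb, xb' + h') \<bullet> h\<close> up to \<open>o(\<epsilon>)\<close>. By the Euler equation this is the total
  derivative of \<open>L_v \<bullet> h\<close>, which integrates to \<open>0\<close>, plus \<open>\<Delta>L_x(t, h') \<bullet> h\<close>. Hence the increment of the
  functional is \<open>\<epsilon>\<^sup>2 / 2 (\<alpha>\<^sup>2 \<Delta>L_x(\<tau>, p) \<bullet> p - \<beta>\<^sup>2 \<Delta>L_x(\<tau>, q) \<bullet> q) + o(\<epsilon>\<^sup>2)\<close>, so the bracket is nonnegative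
  at a local minimum. Interchanging the two slopes reverses its sign, so it is zero. The derivative
  of \<open>h\<close> takes only the values \<open>p\<close>, \<open>q\<close> and \<open>0\<close>, so small \<open>p\<close>, \<open>q\<close> suffice for a weak minimum.
\<close>

section \<open>Integrability of functions with one-sided limits\<close>

text \<open>Overwriting \<open>f\<close> at the two endpoints with its one-sided limits yields a
  continuous function on a compact interval, and two points do not affect the integral.\<close>

lemma integrable_on_limits_at_ends:
  fixes f :: "real \<Rightarrow> 'a::euclidean_space"
  assumes "u < v" and cont: "continuous_on {u<..<v} f"
    and l: "(f \<longlongrightarrow> l) (at_right u)" and r: "(f \<longlongrightarrow> r) (at_left v)"
  shows "f integrable_on {u..v}"
proof -
  let ?g = "f(u := l, v := r)"
  have "continuous_on {u..v} ?g"
  proof (rule continuous_on_IccI)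
    show "(?g \<longlongrightarrow> ?g u) (at_right u)"
      using \<open>u < v\<close> eventually_at_right_real[OF \<open>u < v\<close>]
      by (auto intro!: Lim_transform_eventually[OF l] elim!: eventually_mono)
    show "(?g \<longlongrightarrow> ?g v) (at_left v)"
      using \<open>u < v\<close> eventually_at_left_real[OF \<open>u < v\<close>]
      by (auto intro!: Lim_transform_eventually[OF r] elim!: eventually_mono)
    show "(?g \<longlongrightarrow> ?g t) (at t)" if "u < t" "t < v" for t
    proof -
      have "(f \<longlongrightarrow> f t) (at t)"
        using cont that by (simp add: continuous_on_def at_within_open[of _ "{u<..<v}"])
      then show ?thesis
        using that eventually_at_in_open'[of "{u<..<v}" t]
        by (auto elim!: Lim_transform_eventually eventually_mono)
    qed
  qed (rule \<open>u < v\<close>)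
  then have "?g integrable_on {u..v}"
    by (rule integrable_continuous_interval)
  then show ?thesis
    by (rule integrable_spike_finite[of "{u, v}", rotated 2]) auto
qed

text \<open>By compactness it suffices to integrate over all small intervals containing a given
  \<open>t\<close>. Near \<open>t\<close> no other point of \<open>S\<close> occurs, so cutting at
  \<open>t\<close> leaves pieces that are continuous inside and have limits at their ends.\<close>

lemma integrable_on_one_sided_limits:
  fixes f :: "real \<Rightarrow> 'a::euclidean_space"
  assumes "finite S"
    and cont: "\<And>t. t \<in> {a..b} - S \<Longrightarrow> continuous (at t within {a..b}) f"
    and left: "\<And>t. t \<in> {a<..b} \<Longrightarrow> \<exists>l. (f \<longlongrightarrow> l) (at_left t)"
    and right: "\<And>t. t \<in> {a..<b} \<Longrightarrow> \<exists>r. (f \<longlongrightarrow> r) (at_right t)"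
  shows "f integrable_on {a..b}"
proof -
  have "\<exists>d>0. \<forall>u v. t \<in> cbox u v \<and> cbox u v \<subseteq> ball t d \<and> cbox u v \<subseteq> cbox a b \<longrightarrow>
          f integrable_on cbox u v" if t: "t \<in> {a..b}" for t
  proof -
    obtain d where d: "d > 0" "\<And>y. y \<in> S \<Longrightarrow> y \<noteq> t \<Longrightarrow> d \<le> dist t y"
      using finite_set_avoid[OF \<open>finite S\<close>, of t] by blast
    have piece: "f integrable_on {u..v}"
      if uv: "u \<le> v" "{u..v} \<subseteq> ball t d" "{u..v} \<subseteq> {a..b}" "t \<notin> {u<..<v}" for u v
    proof (cases "u = v")
      case False
      have c: "continuous (at y within {a..b}) f" if "y \<in> {u<..<v}" for y
      proof (rule cont)
        have "y \<in> {u..v}" "y \<noteq> t" using that uv(4) by auto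
        then have "dist t y < d" "y \<in> {a..b}" using uv(2,3) by (auto simp: subset_iff)
        then show "y \<in> {a..b} - S" using d(2)[of y] \<open>y \<noteq> t\<close> by auto
      qed
      then have "continuous (at y within {u<..<v}) f" if "y \<in> {u<..<v}" for y
        using that order_trans[OF greaterThanLessThan_subseteq_atLeastAtMost_iff[THEN iffD2] uv(3), of u v]
        by (intro continuous_within_subset[OF c]) auto
      then have "continuous_on {u<..<v} f"
        by (simp add: continuous_on_eq_continuous_within)
      moreover have "u \<in> {a..<b}" "v \<in> {a<..b}" using uv False by auto
      ultimately show ?thesis
        using integrable_on_limits_at_ends left right uv(1) False
        by (metis order_le_less)
    qed (use integrable_on_refl[of f v] in simp)
    have "f integrable_on {u..v}"
      if uv: "t \<in> {u..v}" "{u..v} \<subseteq> ball t d" "{u..v} \<subseteq> {a..b}" for u v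
    proof (rule Henstock_Kurzweil_Integration.integrable_combine)
      show "f integrable_on {u..t}" "f integrable_on {t..v}"
        using uv by (auto intro!: piece simp: subset_iff)
    qed (use uv in auto)
    then show ?thesis using \<open>d > 0\<close> by (auto intro!: exI[of _ d])
  qed
  then show ?thesis
    using integrable_on_little_subintervals[of a b f] by simp
qed

section \<open>Ramps added to piecewise-smooth functions\<close>

text \<open>At an angular point the limits are part of \<open>KC1\<close>; elsewhere the velocity is
  continuous within \<open>{t0..t1}\<close>, and the one-sided filters refine that one.\<close>

lemma KC1_velocity_limits:
  assumes "KC1 t0 t1 x"
  shows "t \<in> {t0<..t1} \<Longrightarrow> \<exists>l. (velocity t0 t1 x \<longlongrightarrow> l) (at_left t)"
    and "t \<in> {t0..<t1} \<Longrightarrow> \<exists>r. (velocity t0 t1 x \<longlongrightarrow> r) (at_right t)"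
proof -
  have lim: "(velocity t0 t1 x \<longlongrightarrow> velocity t0 t1 x t) (at t within {t0..t1})"
    if "t \<in> {t0..t1}" "t \<notin> angular_points t0 t1 x" for t
    using that by (auto simp: angular_points_def continuous_within)
  show "\<exists>l. (velocity t0 t1 x \<longlongrightarrow> l) (at_left t)" if "t \<in> {t0<..t1}"
  proof (cases "t \<in> angular_points t0 t1 x")
    case False
    then have "(velocity t0 t1 x \<longlongrightarrow> velocity t0 t1 x t) (at t within {t0..t})"
      using that by (intro tendsto_within_subset[OF lim]) auto
    then show ?thesis using that at_within_Icc_at_left[of t0 t] by auto
  qed (use assms in \<open>auto simp: KC1_def\<close>)
  show "\<exists>r. (velocity t0 t1 x \<longlongrightarrow> r) (at_right t)" if "t \<in> {t0..<t1}"
  proof (cases "t \<in> angular_points t0 t1 x")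
    case False
    then have "(velocity t0 t1 x \<longlongrightarrow> velocity t0 t1 x t) (at t within {t..t1})"
      using that by (intro tendsto_within_subset[OF lim]) auto
    then show ?thesis using that at_within_Icc_at_right[of t t1] by auto
  qed (use assms in \<open>auto simp: KC1_def\<close>)
qed

text \<open>The ramp with kink at \<open>s\<close> is the building block of the variation: the
  sawtooth is a sum of three of them.\<close>

lemma has_vector_derivative_ramp:
  assumes "t \<noteq> s"
  shows "((\<lambda>t. max 0 (t - s) *\<^sub>R c) has_vector_derivative (if s < t then c else 0)) (at t within S)"
proof (cases "s < t")
  case True
  have "((\<lambda>t. max 0 (t - s) *\<^sub>R c) has_vector_derivative c) (at t)"
    by (rule has_vector_derivative_transform_within_open[of "\<lambda>t. (t - s) *\<^sub>R c" _ _ "{s<..}"])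
       (use True in \<open>auto intro!: derivative_eq_intros simp: has_vector_derivative_def\<close>)
  then show ?thesis using True by (auto intro: has_vector_derivative_at_within)
next
  case False
  have "((\<lambda>t. max 0 (t - s) *\<^sub>R c) has_vector_derivative 0) (at t)"
    by (rule has_vector_derivative_transform_within_open[of "\<lambda>t. 0" _ _ "{..<s}"])
       (use False assms in auto)
  then show ?thesis using False by (auto intro: has_vector_derivative_at_within)
qed

lemma velocity_add_ramp:
  assumes "t0 < t1" "t \<in> {t0..t1} - insert s (angular_points t0 t1 x)"
  shows "velocity t0 t1 (\<lambda>t. x t + max 0 (t - s) *\<^sub>R c) t
           = velocity t0 t1 x t + (if s < t then c else 0)"
    and "(\<lambda>t. x t + max 0 (t - s) *\<^sub>R c) differentiable (at t within {t0..t1})"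
proof -
  have "(x has_vector_derivative velocity t0 t1 x t) (at t within {t0..t1})"
    using assms unfolding velocity_def
    by (subst vector_derivative_works[symmetric]) (auto simp: angular_points_def)
  then have *: "((\<lambda>t. x t + max 0 (t - s) *\<^sub>R c) has_vector_derivative
      velocity t0 t1 x t + (if s < t then c else 0)) (at t within {t0..t1})"
    using assms by (intro has_vector_derivative_add has_vector_derivative_ramp) auto
  then show "velocity t0 t1 (\<lambda>t. x t + max 0 (t - s) *\<^sub>R c) t
           = velocity t0 t1 x t + (if s < t then c else 0)"
    unfolding velocity_def[of _ _ "\<lambda>t. x t + max 0 (t - s) *\<^sub>R c"]
    using assms by (intro vector_derivative_within_cbox[unfolded box_real]) auto
  show "(\<lambda>t. x t + max 0 (t - s) *\<^sub>R c) differentiable (at t within {t0..t1})"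
    using * differentiableI_vector by blast
qed

text \<open>A ramp changes the velocity by a step function, so the only new angular point can be the
  kink \<open>s\<close>, which lies in the open interval. Adding ramps one at a time then keeps the
  whole sawtooth inside \<open>KC1\<close>.\<close>

lemma KC1_add_ramp:
  assumes "t0 < t1" "KC1 t0 t1 x" "s \<in> {t0<..<t1}"
  shows "angular_points t0 t1 (\<lambda>t. x t + max 0 (t - s) *\<^sub>R c) \<subseteq> insert s (angular_points t0 t1 x)"
    and "KC1 t0 t1 (\<lambda>t. x t + max 0 (t - s) *\<^sub>R c)"
proof -
  let ?y = "\<lambda>t. x t + max 0 (t - s) *\<^sub>R c"
  let ?A = "insert s (angular_points t0 t1 x)"
  let ?w = "\<lambda>t. velocity t0 t1 x t + (if s < t then c else 0)"
  have fin: "finite ?A" using assms by (auto simp: KC1_def)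
  \<comment> \<open>A finite set has no limit point, so the velocity formula, known only outside
    \<open>?A\<close>, holds on punctured neighbourhoods and determines all limits.\<close>
  have ev: "eventually (\<lambda>u. u \<notin> ?A) (at t within S)" for t :: real and S
  proof -
    have "\<not> t islimpt ?A" using fin by (simp add: islimpt_finite)
    then show ?thesis
      by (auto simp: islimpt_iff_eventually eventually_at_filter elim: eventually_mono)
  qed
  have ev': "eventually (\<lambda>u. ?w u = velocity t0 t1 ?y u) (at t within {t0..t1})" for t
    using ev[of t "{t0..t1}"] velocity_add_ramp(1)[OF assms(1), of _ s x c]
    by (auto simp: eventually_at_filter elim!: eventually_mono)
  show ang: "angular_points t0 t1 ?y \<subseteq> ?A"
  proof (rule ccontr)
    assume "\<not> ?thesis"
    then obtain t where t: "t \<in> {t0..t1} - ?A" "\<not> continuous (at t within {t0..t1}) (velocity t0 t1 ?y)"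
      using velocity_add_ramp(2)[OF assms(1)] unfolding angular_points_def by blast
    have "(velocity t0 t1 x \<longlongrightarrow> velocity t0 t1 x t) (at t within {t0..t1})"
      using t by (auto simp: angular_points_def continuous_within)
    moreover have "((\<lambda>u. if s < u then c else 0) \<longlongrightarrow> (if s < t then c else 0)) (at t within {t0..t1})"
    proof (rule tendsto_eventually)
      have "eventually (\<lambda>u. (s < u) = (s < t)) (nhds t)"
      proof (cases "s < t")
        case True
        then show ?thesis using eventually_nhds_in_open[of "{s<..}" t] by (auto elim!: eventually_mono)
      next
        case False
        then show ?thesis using t eventually_nhds_in_open[of "{..<s}" t] by (auto elim!: eventually_mono)
      qed
      then show "eventually (\<lambda>u. (if s < u then c else 0) = (if s < t then c else 0)) (at t within {t0..t1})"
        unfolding eventually_at_filter by (rule eventually_mono) simp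
    qed
    ultimately have "(?w \<longlongrightarrow> ?w t) (at t within {t0..t1})"
      by (rule tendsto_add)
    then have "(velocity t0 t1 ?y \<longlongrightarrow> ?w t) (at t within {t0..t1})"
      by (rule Lim_transform_eventually[OF _ ev'])
    then show False
      using t(2) unfolding continuous_within velocity_add_ramp(1)[OF assms(1) t(1)] by contradiction
  qed
  have step: "\<exists>l. ((\<lambda>u. if s < u then c else 0) \<longlongrightarrow> l) (at_left t)"
    "\<exists>l. ((\<lambda>u. if s < u then c else 0) \<longlongrightarrow> l) (at_right t)" for t
  proof -
    have "eventually (\<lambda>u. (s < u) = (s < t)) (at_left t)"
    proof (cases "s < t")
      case True
      then show ?thesis by (rule eventually_mono[OF eventually_at_left_real]) auto
    next
      case False
      then show ?thesis by (intro eventually_mono[OF eventually_at_left_real[of "t - 1" t]]) auto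
    qed
    then show "\<exists>l. ((\<lambda>u. if s < u then c else 0) \<longlongrightarrow> l) (at_left t)"
      by (intro exI[of _ "if s < t then c else 0"] tendsto_eventually) (erule eventually_mono, simp)
    \<comment> \<open>At \<open>t = s\<close> the step has already jumped when seen from the right,
      hence \<open>\<le>\<close> here and \<open><\<close> for the left limit.\<close>
    have "eventually (\<lambda>u. (s < u) = (s \<le> t)) (at_right t)"
    proof (cases "s \<le> t")
      case True
      then show ?thesis by (intro eventually_mono[OF eventually_at_right_real[of t "t + 1"]]) auto
    next
      case False
      then show ?thesis by (intro eventually_mono[OF eventually_at_right_real[of t s]]) auto
    qed
    then show "\<exists>l. ((\<lambda>u. if s < u then c else 0) \<longlongrightarrow> l) (at_right t)"
      by (intro exI[of _ "if s \<le> t then c else 0"] tendsto_eventually) (erule eventually_mono, simp)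
  qed
  have lims: "(\<exists>l. (velocity t0 t1 ?y \<longlongrightarrow> l) (at_left t)) \<and> (\<exists>r. (velocity t0 t1 ?y \<longlongrightarrow> r) (at_right t))"
    if t: "t \<in> {t0<..<t1}" for t
  proof -
    have "at t within {t0..t1} = at t" using t by (simp add: at_within_Icc_at)
    then have ev2: "eventually (\<lambda>u. ?w u = velocity t0 t1 ?y u) (at_left t)"
      "eventually (\<lambda>u. ?w u = velocity t0 t1 ?y u) (at_right t)"
      using ev'[of t] by (auto simp: eventually_at_split)
    obtain l1 l2 where "(velocity t0 t1 x \<longlongrightarrow> l1) (at_left t)" "(velocity t0 t1 x \<longlongrightarrow> l2) (at_right t)"
      using KC1_velocity_limits[OF assms(2), of t] t by auto
    moreover obtain k1 k2 where "((\<lambda>u. if s < u then c else 0) \<longlongrightarrow> k1) (at_left t)"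
      "((\<lambda>u. if s < u then c else 0) \<longlongrightarrow> k2) (at_right t)"
      using step by metis
    ultimately have "(?w \<longlongrightarrow> l1 + k1) (at_left t)" "(?w \<longlongrightarrow> l2 + k2) (at_right t)"
      by (auto intro: tendsto_add)
    then show ?thesis using ev2 Lim_transform_eventually by blast
  qed
  show "KC1 t0 t1 ?y"
    unfolding KC1_def
  proof (intro conjI ballI)
    show "continuous_on {t0..t1} ?y"
      using assms by (auto simp: KC1_def intro!: continuous_intros)
    show "finite (angular_points t0 t1 ?y)" using ang fin finite_subset by blast
    show "angular_points t0 t1 ?y \<subseteq> {t0<..<t1}"
      using ang assms by (auto simp: KC1_def)
    then show "\<exists>l. (velocity t0 t1 ?y \<longlongrightarrow> l) (at_left t)"
      "\<exists>l. (velocity t0 t1 ?y \<longlongrightarrow> l) (at_right t)" if "t \<in> angular_points t0 t1 ?y" for t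
      using lims that by auto
  qed
qed

section \<open>Partial gradients and integrability of the Lagrangian\<close>

lemma gradient_eq:
  assumes "GDERIV f x :> D"
  shows "gradient f x = D"
  unfolding gradient_def
proof (rule the_equality)
  show "GDERIV f x :> D" by (rule assms)
next
  fix D' assume "GDERIV f x :> D'"
  then have "(\<lambda>h. h \<bullet> D') = (\<lambda>h. h \<bullet> D)"
    using assms has_derivative_unique unfolding gderiv_def by blast
  then show "D' = D"
    by (metis vector_eq_rdot inner_commute)
qed

lemma L_x_continuously_differentiable:
  fixes L :: "'n::finite integrand"
  assumes "continuously_differentiable_on (\<lambda>(t, x, v). L t x v) (D \<times> UNIV \<times> UNIV)"
  shows "t \<in> D \<Longrightarrow> GDERIV (\<lambda>y. L t y v) x :> L_x L t x v"
    and "continuous_on (D \<times> UNIV \<times> UNIV) (\<lambda>(t, x, v). L_x L t x v)"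
proof -
  obtain f' where f': "\<And>p. p \<in> D \<times> UNIV \<times> UNIV \<Longrightarrow>
      ((\<lambda>(t, x, v). L t x v) has_derivative blinfun_apply (f' p)) (at p)"
    and cont: "continuous_on (D \<times> UNIV \<times> UNIV) f'"
    using assms unfolding continuously_differentiable_on_def by blast
  \<comment> \<open>\<open>G p\<close> is the vector representing the functional
    \<open>\<lambda>k. f' p (0, k, 0)\<close>, the derivative in the second argument. Written in
    coordinates it inherits continuity from \<open>f'\<close>.\<close>
  define G where "G p = (\<Sum>i\<in>Basis. blinfun_apply (f' p) (0, i, 0) *\<^sub>R i)" for p
  have G: "GDERIV (\<lambda>y. L t y v) x :> G (t, x, v)" if "t \<in> D" for t x v
  proof -
    have "((\<lambda>y. (t, y, v)) has_derivative (\<lambda>k. (0, k, 0))) (at x)"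
      by (auto intro!: derivative_eq_intros)
    then have "((\<lambda>y. L t y v) has_derivative (\<lambda>k. blinfun_apply (f' (t, x, v)) (0, k, 0))) (at x)"
      using has_derivative_compose[of "\<lambda>y. (t, y, v)" _ x UNIV "\<lambda>(t, x, v). L t x v", OF _ f'] that
      by fastforce
    moreover have "blinfun_apply (f' (t, x, v)) (0, k, 0) = k \<bullet> G (t, x, v)" for k
    proof -
      have "linear (\<lambda>k. blinfun_apply (f' (t, x, v)) (0, k, 0))"
        using calculation has_derivative_linear by blast
      then have "blinfun_apply (f' (t, x, v)) (0, (\<Sum>i\<in>Basis. (k \<bullet> i) *\<^sub>R i), 0)
          = (\<Sum>i\<in>Basis. (k \<bullet> i) *\<^sub>R blinfun_apply (f' (t, x, v)) (0, i, 0))"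
        using linear_sum[of "\<lambda>k. blinfun_apply (f' (t, x, v)) (0, k, 0)" "\<lambda>i. (k \<bullet> i) *\<^sub>R i"  Basis]
          linear_scale[of "\<lambda>k. blinfun_apply (f' (t, x, v)) (0, k, 0)"]
        by (simp only: linear_sum linear_scale o_def)
      then show ?thesis
        by (simp add: G_def inner_sum_right euclidean_representation mult.commute)
    qed
    ultimately show ?thesis by (simp add: gderiv_def)
  qed
  then have eq: "L_x L t x v = G (t, x, v)" if "t \<in> D" for t x v
    using gradient_eq that unfolding L_x_def by blast
  show "t \<in> D \<Longrightarrow> GDERIV (\<lambda>y. L t y v) x :> L_x L t x v"
    using G eq by simp
  have "continuous_on (D \<times> UNIV \<times> UNIV) G"
    unfolding G_def by (intro continuous_intros cont)
  then show "continuous_on (D \<times> UNIV \<times> UNIV) (\<lambda>(t, x, v). L_x L t x v)"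
    by (rule continuous_on_eq) (auto simp: eq)
qed

text \<open>\<open>integral\<close> returns 0 for a non-integrable function, so integrability must
  be secured before two values of \<open>J\<close> may be compared through the integral of a
  difference.\<close>

lemma KC1_Lagrangian_integrable:
  fixes L :: "'n::finite integrand"
  assumes "t0 < t1" "KC1 t0 t1 x" "{t0..t1} \<subseteq> D"
    and L: "continuous_on (D \<times> UNIV \<times> UNIV) (\<lambda>(t, x, v). L t x v)"
  shows "(\<lambda>t. L t (x t) (velocity t0 t1 x t)) integrable_on {t0..t1}"
proof -
  let ?f = "\<lambda>t. L t (x t) (velocity t0 t1 x t)"
  \<comment> \<open>Stating the limit for every filter finer than
    \<open>at t within {t0..t1}\<close> covers continuity and both one-sided limits at once.\<close>
  have lim: "(?f \<longlongrightarrow> L t (x t) l) F"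
    if "t \<in> {t0..t1}" "F \<le> at t within {t0..t1}" "(velocity t0 t1 x \<longlongrightarrow> l) F" for t l F
  proof -
    have "(x \<longlongrightarrow> x t) (at t within {t0..t1})"
      using assms that by (auto simp: KC1_def continuous_on_def)
    then have "(x \<longlongrightarrow> x t) F" using that(2) tendsto_mono by blast
    moreover have "((\<lambda>s. s) \<longlongrightarrow> t) F" using that(2) tendsto_mono tendsto_ident_at by blast
    ultimately have "((\<lambda>s. (s, x s, velocity t0 t1 x s)) \<longlongrightarrow> (t, x t, l)) F"
      using that(3) by (intro tendsto_Pair)
    moreover have "eventually (\<lambda>s. s \<in> {t0..t1}) (at t within {t0..t1})"
      by (simp add: eventually_at_filter)
    then have "eventually (\<lambda>s. (s, x s, velocity t0 t1 x s) \<in> D \<times> UNIV \<times> UNIV) F"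
      using that(2) assms(3) by (intro filter_leD[OF that(2)]) (auto elim!: eventually_mono)
    ultimately show ?thesis
      using continuous_on_tendsto_compose[OF L] that(1) assms(3) by fastforce
  qed
  show ?thesis
  proof (rule integrable_on_one_sided_limits)
    show "finite (angular_points t0 t1 x)" using assms by (simp add: KC1_def)
    show "continuous (at t within {t0..t1}) ?f" if "t \<in> {t0..t1} - angular_points t0 t1 x" for t
      using that lim[of t "at t within {t0..t1}"] by (auto simp: continuous_within angular_points_def)
    show "\<exists>l. (?f \<longlongrightarrow> l) (at_left t)" if "t \<in> {t0<..t1}" for t
    proof -
      have "at_left t \<le> at t within {t0..t1}"
        using that by (subst at_within_Icc_at_left[of t0 t, symmetric]) (auto intro: at_le)
      then show ?thesis
        using lim[of t "at_left t"] KC1_velocity_limits(1)[OF assms(2) that] that by force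
    qed
    show "\<exists>r. (?f \<longlongrightarrow> r) (at_right t)" if "t \<in> {t0..<t1}" for t
    proof -
      have "at_right t \<le> at t within {t0..t1}"
        using that by (subst at_within_Icc_at_right[of t t1, symmetric]) (auto intro: at_le)
      then show ?thesis
        using lim[of t "at_right t"] KC1_velocity_limits(2)[OF assms(2) that] that by force
    qed
  qed
qed

section \<open>Upper bounds for an increment and for its integral\<close>

text \<open>Mean value theorem on the segment from \<open>x\<close> to \<open>x + k\<close>, with
  the intermediate gradient replaced by a fixed \<open>A\<close>. An upper bound is enough, since
  minimality bounds the increment of the functional from below.\<close>

lemma increment_le_gradient_bound:
  fixes f :: "'a::real_inner \<Rightarrow> real"
  assumes "\<And>y. GDERIV f y :> g y"
    and "\<And>y. norm y \<le> norm k \<Longrightarrow> norm (g (x + y) - A) \<le> e"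
  shows "f (x + k) - f x \<le> A \<bullet> k + e * norm k"
proof -
  have "DERIV (\<lambda>\<theta>. f (x + \<theta> *\<^sub>R k)) \<theta> :> k \<bullet> g (x + \<theta> *\<^sub>R k)" for \<theta>
  proof -
    have "((\<lambda>\<theta>. x + \<theta> *\<^sub>R k) has_derivative (\<lambda>h. h *\<^sub>R k)) (at \<theta>)"
      by (auto intro!: derivative_eq_intros)
    from has_derivative_compose[OF this assms(1)[unfolded gderiv_def]] show ?thesis
      by (simp add: has_field_derivative_def mult_commute_abs)
  qed
  then obtain \<theta> where \<theta>: "0 < \<theta>" "\<theta> < 1" "f (x + k) - f x = k \<bullet> g (x + \<theta> *\<^sub>R k)"
    using MVT2[of 0 1 "\<lambda>\<theta>. f (x + \<theta> *\<^sub>R k)" "\<lambda>\<theta>. k \<bullet> g (x + \<theta> *\<^sub>R k)"] by auto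
  have "norm (g (x + \<theta> *\<^sub>R k) - A) \<le> e"
    using \<theta> by (intro assms(2)) (simp add: mult_left_le_one_le)
  then have "(g (x + \<theta> *\<^sub>R k) - A) \<bullet> k \<le> e * norm k"
    by (meson norm_cauchy_schwarz mult_right_mono norm_ge_zero order_trans)
  then show ?thesis using \<theta>(3) by (simp add: inner_diff_left inner_commute[of k])
qed

text \<open>The right side of \<open>le\<close> is the derivative of
  \<open>(t - c) * (l t \<bullet> p) + \<kappa> / 2 * (t - c)\<^sup>2\<close>. In the application
  \<open>l\<close> and \<open>l'\<close> are \<open>L_v\<close> and \<open>L_x\<close> along the
  extremal, linked by the Euler equation, \<open>(t - c) *\<^sub>R p\<close> is one edge of the
  sawtooth with zero \<open>c\<close>, and \<kappa> carries the \<open>Delta_L_x\<close> term with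
  its error.\<close>

lemma integral_le_total_derivative:
  fixes l l' :: "real \<Rightarrow> 'a::real_inner"
  assumes "u \<le> w" "finite F" and g: "(g has_integral i) {u..w}"
    and l: "\<And>t. t \<in> {u..w} \<Longrightarrow> (l has_vector_derivative l' t) (at t within {u..w})"
    and le: "\<And>t. t \<in> {u..w} - F \<Longrightarrow> g t \<le> l t \<bullet> p + (t - c) * (l' t \<bullet> p) + \<kappa> * (t - c)"
  shows "i \<le> (w - c) * (l w \<bullet> p) - (u - c) * (l u \<bullet> p) + \<kappa> * ((w - c)\<^sup>2 - (u - c)\<^sup>2) / 2"
proof -
  let ?G = "\<lambda>t. (t - c) * (l t \<bullet> p) + \<kappa> / 2 * (t - c)\<^sup>2"
  let ?g = "\<lambda>t. l t \<bullet> p + (t - c) * (l' t \<bullet> p) + \<kappa> * (t - c)"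
  have "(?G has_real_derivative ?g t) (at t within {u..w})" if "t \<in> {u..w}" for t
  proof -
    have "((\<lambda>t. l t \<bullet> p) has_real_derivative l' t \<bullet> p) (at t within {u..w})"
      using bounded_linear.has_vector_derivative[OF bounded_linear_inner_left l[OF that]]
      by (simp add: has_real_derivative_iff_has_vector_derivative)
    then show ?thesis
      by (auto intro!: derivative_eq_intros simp: field_simps)
  qed
  then have "(?g has_integral ?G w - ?G u) {u..w}"
    by (intro fundamental_theorem_of_calculus[OF \<open>u \<le> w\<close>])
       (simp add: has_real_derivative_iff_has_vector_derivative)
  \<comment> \<open>On the finite set \<open>F\<close> the function is replaced by its bound, which
    leaves the integral alone and makes the comparison hold at every point.\<close>
  moreover have "((\<lambda>t. if t \<in> F then ?g t else g t) has_integral i) {u..w}"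
    by (rule has_integral_spike_finite[OF \<open>finite F\<close> _ g]) simp
  ultimately have "i \<le> ?G w - ?G u"
    using le by (intro has_integral_le[of _ i "{u..w}" ?g]) auto
  then show ?thesis by (simp add: algebra_simps diff_divide_distrib)
qed

section \<open>The sawtooth perturbation and its size\<close>

text \<open>The slope jumps by \<open>p\<close>, \<open>q - p\<close> and \<open>- q\<close> at the
  three knots, and \<open>pq\<close> makes the last ramp start at height zero. Each edge is written
  around the knot where it vanishes, the second one thus around the right end, as
  \<open>integral_le_total_derivative\<close> requires.\<close>

lemma sawtooth_variation:
  fixes xb :: "real \<Rightarrow> real^'n::finite"
  assumes "KC1 t0 t1 xb" "t0 < \<tau>" "0 < \<alpha>" "0 < \<beta>" "\<tau> + \<alpha> + \<beta> < t1"
    and pq: "\<alpha> *\<^sub>R p + \<beta> *\<^sub>R q = 0"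
  obtains x F where "finite F"
    "admissible t0 t1 (xb t0) (xb t1) x"
    "\<And>t. t \<notin> {\<tau>..\<tau> + \<alpha> + \<beta>} \<Longrightarrow> x t = xb t"
    "\<And>t. t \<in> {\<tau>..\<tau> + \<alpha>} \<Longrightarrow> x t = xb t + (t - \<tau>) *\<^sub>R p"
    "\<And>t. t \<in> {\<tau> + \<alpha>..\<tau> + \<alpha> + \<beta>} \<Longrightarrow> x t = xb t + (t - (\<tau> + \<alpha> + \<beta>)) *\<^sub>R q"
    "\<And>t. t \<in> {t0..t1} - F \<Longrightarrow> velocity t0 t1 x t = velocity t0 t1 xb t +
       (if t \<in> {\<tau>..\<tau> + \<alpha>} then p else if t \<in> {\<tau> + \<alpha>..\<tau> + \<alpha> + \<beta>} then q else 0)"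
proof -
  define x1 where "x1 = (\<lambda>t. xb t + max 0 (t - \<tau>) *\<^sub>R p)"
  define x2 where "x2 = (\<lambda>t. x1 t + max 0 (t - (\<tau> + \<alpha>)) *\<^sub>R (q - p))"
  define x where "x = (\<lambda>t. x2 t + max 0 (t - (\<tau> + \<alpha> + \<beta>)) *\<^sub>R (- q))"
  define F where "F = {\<tau>, \<tau> + \<alpha>, \<tau> + \<alpha> + \<beta>} \<union> angular_points t0 t1 xb"
  have "t0 < t1" using assms by linarith
  have k1: "KC1 t0 t1 x1" "angular_points t0 t1 x1 \<subseteq> F"
    using KC1_add_ramp[OF \<open>t0 < t1\<close> assms(1), of \<tau> p] assms unfolding x1_def F_def by auto
  have k2: "KC1 t0 t1 x2" "angular_points t0 t1 x2 \<subseteq> F"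
    using KC1_add_ramp[OF \<open>t0 < t1\<close> k1(1), of "\<tau> + \<alpha>" "q - p"] k1(2) assms
    unfolding x2_def F_def by auto
  have k3: "KC1 t0 t1 x"
    using KC1_add_ramp(2)[OF \<open>t0 < t1\<close> k2(1), of "\<tau> + \<alpha> + \<beta>" "- q"] assms
    unfolding x_def by auto
  have pq': "\<alpha> *\<^sub>R p = - (\<beta> *\<^sub>R q)" using pq by (simp add: add_eq_0_iff2)
  have mid: "x t = xb t + (t - (\<tau> + \<alpha> + \<beta>)) *\<^sub>R q" if "t \<in> {\<tau> + \<alpha>..\<tau> + \<alpha> + \<beta>}" for t
  proof -
    have "x t = xb t + \<alpha> *\<^sub>R p + (t - (\<tau> + \<alpha>)) *\<^sub>R q"
      using that assms(3) unfolding x_def x2_def x1_def by (simp add: max_def algebra_simps)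
    then show ?thesis unfolding pq' by (simp add: algebra_simps)
  qed
  show thesis
  proof
    show "finite F" using assms by (simp add: F_def KC1_def)
    show off: "x t = xb t" if "t \<notin> {\<tau>..\<tau> + \<alpha> + \<beta>}" for t
    proof (cases "t < \<tau>")
      case True
      then show ?thesis using assms(3,4) unfolding x_def x2_def x1_def by (simp add: max_def)
    next
      case False
      then have "x t = xb t + \<alpha> *\<^sub>R p + \<beta> *\<^sub>R q"
        using that assms(3,4) unfolding x_def x2_def x1_def by (simp add: max_def algebra_simps)
      then show ?thesis unfolding pq' by simp
    qed
    show "x t = xb t + (t - \<tau>) *\<^sub>R p" if "t \<in> {\<tau>..\<tau> + \<alpha>}" for t
      using that assms(4) unfolding x_def x2_def x1_def by (simp add: max_def)
    show "admissible t0 t1 (xb t0) (xb t1) x"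
      using k3 off[of t0] off[of t1] assms by (simp add: admissible_def)
    show "velocity t0 t1 x t = velocity t0 t1 xb t +
       (if t \<in> {\<tau>..\<tau> + \<alpha>} then p else if t \<in> {\<tau> + \<alpha>..\<tau> + \<alpha> + \<beta>} then q else 0)"
      if t: "t \<in> {t0..t1} - F" for t
    proof -
      have "t \<notin> angular_points t0 t1 x1" "t \<notin> angular_points t0 t1 x2" using t k1(2) k2(2) by auto
      moreover have "velocity t0 t1 x1 t = velocity t0 t1 xb t + (if \<tau> < t then p else 0)"
        using t velocity_add_ramp(1)[OF \<open>t0 < t1\<close>, of t \<tau> xb p] by (simp add: F_def x1_def)
      moreover have "velocity t0 t1 x2 t = velocity t0 t1 x1 t + (if \<tau> + \<alpha> < t then q - p else 0)"
        using t calculation(1) velocity_add_ramp(1)[OF \<open>t0 < t1\<close>, of t "\<tau> + \<alpha>" x1 "q - p"]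
        by (simp add: F_def x2_def)
      moreover have "velocity t0 t1 x t = velocity t0 t1 x2 t + (if \<tau> + \<alpha> + \<beta> < t then - q else 0)"
        using t calculation(2) velocity_add_ramp(1)[OF \<open>t0 < t1\<close>, of t "\<tau> + \<alpha> + \<beta>" x2 "- q"]
        by (simp add: F_def x_def)
      moreover have "t \<noteq> \<tau>" "t \<noteq> \<tau> + \<alpha>" "t \<noteq> \<tau> + \<alpha> + \<beta>" using t by (auto simp: F_def)
      ultimately show ?thesis using assms(3,4) by auto
    qed
  qed (fact mid)
qed

text \<open>A velocity difference is unspecified at finitely many points. Agreement with a Borel
  function off \<open>F\<close> supplies both the measurability that \<open>esssup_I\<close> asks
  for and the bound almost everywhere.\<close>

lemma Linf_norm_le:
  assumes "finite F" and f: "\<And>t. t \<in> {t0..t1} - F \<Longrightarrow> f t = g t"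
    and g: "g \<in> borel_measurable borel" "\<And>t. norm (g t) \<le> M"
  shows "Linf_norm t0 t1 f \<le> ereal M"
  unfolding Linf_norm_def
proof (rule esssup_I)
  have g': "g \<in> borel_measurable (lebesgue_on {t0..t1})"
    using g(1) by (simp add: measurable_restrict_space1 measurable_completion)
  have "f \<in> borel_measurable (lebesgue_on {t0..t1})"
  proof (rule measurable_discrete_difference[OF g', where X = "F \<inter> {t0..t1}"])
    show "countable (F \<inter> {t0..t1})" using assms(1) by (simp add: countable_finite)
    show "{t} \<in> sets (lebesgue_on {t0..t1})" if "t \<in> F \<inter> {t0..t1}" for t
      using that by (simp add: sets_restrict_space_iff)
  qed (use f in auto)
  then show "(\<lambda>t. ereal (norm (f t))) \<in> borel_measurable (lebesgue_on {t0..t1})"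
    by measurable
  have "AE t in lebesgue_on {t0..t1}. t \<notin> F"
    using AE_not_in[of F lebesgue] negligible_finite[OF assms(1)]
    by (auto simp: AE_restrict_space_iff negligible_iff_null_sets)
  then show "AE t in lebesgue_on {t0..t1}. ereal (norm (f t)) \<le> ereal M"
    using AE_space by eventually_elim (use f g(2) in auto)
qed

section \<open>Uniform behaviour of \<open>L_x\<close> near an interior point\<close>

lemma velocity_continuous_on:
  assumes "{s0<..<s1} \<subseteq> {t0..t1}" "{s0<..<s1} \<inter> angular_points t0 t1 x = {}"
  shows "continuous_on {s0<..<s1} (velocity t0 t1 x)"
  unfolding continuous_on_eq_continuous_within
proof
  fix t assume t: "t \<in> {s0<..<s1}"
  then have "t \<in> {t0..t1} - angular_points t0 t1 x" using assms by auto
  then have "continuous (at t within {t0..t1}) (velocity t0 t1 x)"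
    by (simp add: angular_points_def)
  then show "continuous (at t within {s0<..<s1}) (velocity t0 t1 x)"
    using assms(1) by (rule continuous_within_subset)
qed

text \<open>This is continuity of \<open>\<phi>\<close> at \<open>(\<tau>, 0)\<close>, where its
  value is \<open>Delta_L_x L t0 t1 xb \<tau> \<xi>\<close>. The term
  \<open>L_x L t (xb t) (velocity t0 t1 xb t)\<close> is kept at the moving time \<open>t\<close>,
  so that the Euler equation can later be applied to it exactly.\<close>

lemma L_x_locally_uniform:
  fixes L :: "'n::finite integrand"
  assumes "continuous_on (D \<times> UNIV \<times> UNIV) (\<lambda>(t, x, v). L_x L t x v)"
    and "{t0..t1} \<subseteq> D" "KC1 t0 t1 xb"
    and s: "{s0<..<s1} \<subseteq> {t0..t1}" "{s0<..<s1} \<inter> angular_points t0 t1 xb = {}"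
    and "\<tau> \<in> {s0<..<s1}" "0 < e"
  shows "\<exists>r>0. \<forall>t\<in>{s0<..<s1}. \<forall>y. \<bar>t - \<tau>\<bar> < r \<longrightarrow> norm y < r \<longrightarrow>
    norm (L_x L t (xb t + y) (velocity t0 t1 xb t + \<xi>)
      - (L_x L t (xb t) (velocity t0 t1 xb t) + Delta_L_x L t0 t1 xb \<tau> \<xi>)) \<le> e"
proof -
  let ?S = "{s0<..<s1} \<times> (UNIV :: (real^'n) set)"
  let ?v = "velocity t0 t1 xb"
  define \<phi> where "\<phi> = (\<lambda>(t, y). L_x L t (xb t + y) (?v t + \<xi>) - L_x L t (xb t) (?v t))"
  have xb: "continuous_on {s0<..<s1} xb"
    using assms(3) s(1) continuous_on_subset by (auto simp: KC1_def)
  have v: "continuous_on {s0<..<s1} ?v" using velocity_continuous_on[OF s] .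
  have [continuous_intros]: "continuous_on ?S (\<lambda>z. xb (fst z))" "continuous_on ?S (\<lambda>z. ?v (fst z))"
    by (auto intro!: continuous_on_compose2[OF xb] continuous_on_compose2[OF v] continuous_intros)
  have "continuous_on ?S (\<lambda>z. (\<lambda>(t, x, v). L_x L t x v) (fst z, xb (fst z) + snd z, ?v (fst z) + \<xi>)
      - (\<lambda>(t, x, v). L_x L t x v) (fst z, xb (fst z), ?v (fst z)))"
    using assms(2) s(1)
    by (intro continuous_on_diff continuous_on_compose2[OF assms(1)] continuous_intros) auto
  then have "continuous_on ?S \<phi>"
    by (simp add: \<phi>_def case_prod_beta)
  then obtain r where r: "r > 0"
    "\<And>z. z \<in> ?S \<Longrightarrow> dist z (\<tau>, 0) < r \<Longrightarrow> dist (\<phi> z) (\<phi> (\<tau>, 0)) < e"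
    using assms(6,7) unfolding continuous_on_iff by (metis SigmaI UNIV_I)
  have "norm (L_x L t (xb t + y) (?v t + \<xi>) - (L_x L t (xb t) (?v t) + Delta_L_x L t0 t1 xb \<tau> \<xi>)) \<le> e"
    if "t \<in> {s0<..<s1}" "\<bar>t - \<tau>\<bar> < r / 2" "norm y < r / 2" for t y
  proof -
    have "dist (t, y) (\<tau>, 0) \<le> \<bar>t - \<tau>\<bar> + norm y"
      using sqrt_sum_squares_le_sum_abs[of "t - \<tau>" "norm y"] by (simp add: dist_Pair_Pair dist_real_def)
    then have "dist (\<phi> (t, y)) (\<phi> (\<tau>, 0)) < e"
      using that by (intro r(2)) auto
    then show ?thesis
      by (simp add: \<phi>_def dist_norm Delta_L_x_def algebra_simps)
  qed
  \<comment> \<open>Half of \<open>r\<close>, because the distance in the product is bounded by the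
    sum of the two distances.\<close>
  then show ?thesis using \<open>r > 0\<close> by (intro exI[of _ "r / 2"]) auto
qed


section \<open>The inequality obtained from one sawtooth\<close>

text \<open>One sign of the bracket. The premise \<open>min\<close> is shaped to follow from either
  kind of minimum: shrinking \<epsilon> makes the sawtooth small in \<open>C_norm\<close>, while its
  slopes remain \<open>p\<close> and \<open>q\<close>, whence the maximum of their norms as bound
  for \<open>Linf_norm\<close>.\<close>

lemma degenerate_imp_inequality:
  fixes L :: "'n::finite integrand" and xb :: "real \<Rightarrow> real^'n"
  assumes "t0 < t1" "{t0..t1} \<subseteq> D"
    and C1: "continuously_differentiable_on (\<lambda>(t, x, v). L t x v) (D \<times> UNIV \<times> UNIV)"
    and ext: "extremal L t0 t1 x0 x1 xb"
    and s: "{s0<..<s1} \<subseteq> {t0..t1}" "{s0<..<s1} \<inter> angular_points t0 t1 xb = {}"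
    and \<tau>: "\<tau> \<in> {s0<..<s1}" and "0 < \<alpha>" "0 < \<beta>" "\<alpha> *\<^sub>R p + \<beta> *\<^sub>R q = 0"
    and E: "\<And>t. t \<in> {s0<..<s1} \<Longrightarrow> Weierstrass_E L t0 t1 xb t p = 0"
      "\<And>t. t \<in> {s0<..<s1} \<Longrightarrow> Weierstrass_E L t0 t1 xb t q = 0"
    and "0 < d"
    and min: "\<And>x. admissible t0 t1 x0 x1 x \<Longrightarrow> C_norm t0 t1 (\<lambda>t. x t - xb t) \<le> ereal d \<Longrightarrow>
      Linf_norm t0 t1 (\<lambda>t. velocity t0 t1 x t - velocity t0 t1 xb t) \<le> ereal (max (norm p) (norm q)) \<Longrightarrow>
      J L t0 t1 xb \<le> J L t0 t1 x"
  shows "\<beta>\<^sup>2 * (Delta_L_x L t0 t1 xb \<tau> q \<bullet> q) \<le> \<alpha>\<^sup>2 * (Delta_L_x L t0 t1 xb \<tau> p \<bullet> p)"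
proof -
  let ?v = "velocity t0 t1 xb"
  let ?\<Delta> = "Delta_L_x L t0 t1 xb \<tau>"
  define l where "l t = L_v L t (xb t) (?v t)" for t
  define l' where "l' t = L_x L t (xb t) (?v t)" for t
  have KC1: "KC1 t0 t1 xb" and ends: "xb t0 = x0" "xb t1 = x1"
    using ext by (auto simp: extremal_def admissible_def)
  have \<tau>': "t0 < \<tau>" "s1 \<le> t1"
  proof -
    \<comment> \<open>Passing to the closure turns the inclusion of the open interval into
      inequalities between endpoints.\<close>
    have "closure {s0<..<s1} \<subseteq> {t0..t1}" using s(1) by (simp add: closure_minimal)
    then show "t0 < \<tau>" "s1 \<le> t1" using \<tau> by auto
  qed
  have Euler: "(l has_vector_derivative l' t) (at t within {u..w})"
    if "t \<in> {s0<..<s1}" "{u..w} \<subseteq> {s0<..<s1}" for t u w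
  proof -
    have "t \<in> {t0..t1} - angular_points t0 t1 xb" using that s by auto
    then have "(l has_vector_derivative l' t) (at t within {t0..t1})"
      using ext unfolding extremal_def l_def l'_def by blast
    then show ?thesis using that(2) s(1) has_vector_derivative_within_subset by blast
  qed
  have L_cont: "continuous_on (D \<times> UNIV \<times> UNIV) (\<lambda>(t, x, v). L t x v)"
    using C1 unfolding continuously_differentiable_on_def
    by (meson has_derivative_continuous continuous_at_imp_continuous_on)
  \<comment> \<open>The error \<open>e\<close> bounds the variation of \<open>L_x\<close> near \<open>\<tau>\<close>; the inequality is the limit \<open>e \<rightarrow> 0\<close>.\<close>
  have key: "0 \<le> \<alpha>\<^sup>2 * (?\<Delta> p \<bullet> p + e * norm p) - \<beta>\<^sup>2 * (?\<Delta> q \<bullet> q - e * norm q)" if "0 < e" for e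
  proof -
    have ex: "\<exists>r>0. \<forall>t\<in>{s0<..<s1}. \<forall>y. \<bar>t - \<tau>\<bar> < r \<longrightarrow> norm y < r \<longrightarrow>
        norm (L_x L t (xb t + y) (?v t + \<xi>) - (l' t + ?\<Delta> \<xi>)) \<le> e" for \<xi>
      unfolding l'_def
      by (rule L_x_locally_uniform[OF L_x_continuously_differentiable(2)[OF C1] assms(2) KC1 s \<tau> \<open>0 < e\<close>])
    obtain r1 r2 where r1: "0 < r1" "\<forall>t\<in>{s0<..<s1}. \<forall>y. \<bar>t - \<tau>\<bar> < r1 \<longrightarrow> norm y < r1 \<longrightarrow>
        norm (L_x L t (xb t + y) (?v t + p) - (l' t + ?\<Delta> p)) \<le> e"
      and r2: "0 < r2" "\<forall>t\<in>{s0<..<s1}. \<forall>y. \<bar>t - \<tau>\<bar> < r2 \<longrightarrow> norm y < r2 \<longrightarrow>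
        norm (L_x L t (xb t + y) (?v t + q) - (l' t + ?\<Delta> q)) \<le> e"
      using ex[of p] ex[of q] by blast
    \<comment> \<open>Below \<open>r\<close> both estimates of \<open>L_x\<close> hold, the
      perturbation stays within \<open>d\<close> of \<open>xb\<close>, and the support starting at
      \<tau> ends before \<open>s1\<close>.\<close>
    define r where "r = Min {r1, r2, d, s1 - \<tau>}"
    \<comment> \<open>\<open>M * \<epsilon>\<close> dominates the length \<open>a + b\<close> of the
      support and the height of either edge; \<epsilon> will be chosen to make it
      \<open>r / 2\<close>.\<close>
    define M where "M = (\<alpha> + \<beta>) * (1 + norm p + norm q)"
    have r: "0 < r" "r \<le> r1" "r \<le> r2" "r \<le> d" "r \<le> s1 - \<tau>"
      using r1 r2 \<open>0 < d\<close> \<tau> by (auto simp: r_def)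
    have "0 < M" using \<open>0 < \<alpha>\<close> \<open>0 < \<beta>\<close> by (simp add: M_def add_pos_nonneg)
    define \<epsilon> where "\<epsilon> = r / (2 * M)"
    have \<epsilon>: "0 < \<epsilon>" "M * \<epsilon> < r" using \<open>0 < M\<close> \<open>0 < r\<close> by (auto simp: \<epsilon>_def)
    define a where "a = \<alpha> * \<epsilon>"
    define b where "b = \<beta> * \<epsilon>"
    define c where "c = \<tau> + a + b"
    have ab: "0 < a" "0 < b" using \<epsilon> \<open>0 < \<alpha>\<close> \<open>0 < \<beta>\<close> by (auto simp: a_def b_def)
    have M_eq: "M * \<epsilon> = (a + b) + (a + b) * norm p + (a + b) * norm q"
      by (simp add: M_def a_def b_def algebra_simps)
    have "0 \<le> (a + b) * norm p" "0 \<le> (a + b) * norm q" using ab by auto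
    then have small: "a + b < r" "(a + b) * norm p < r" "(a + b) * norm q < r"
      using \<epsilon>(2) ab unfolding M_eq by linarith+
    have apbq: "a *\<^sub>R p + b *\<^sub>R q = 0"
    proof -
      have "a *\<^sub>R p + b *\<^sub>R q = \<epsilon> *\<^sub>R (\<alpha> *\<^sub>R p + \<beta> *\<^sub>R q)"
        by (simp add: a_def b_def algebra_simps)
      then show ?thesis using assms(10) by simp
    qed
    have "c < t1" using small(1) r(5) \<tau>'(2) by (simp add: c_def)
    obtain x F where "finite F" and adm: "admissible t0 t1 (xb t0) (xb t1) x"
      and off: "\<And>t. t \<notin> {\<tau>..c} \<Longrightarrow> x t = xb t"
      and on1: "\<And>t. t \<in> {\<tau>..\<tau> + a} \<Longrightarrow> x t = xb t + (t - \<tau>) *\<^sub>R p"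
      and on2: "\<And>t. t \<in> {\<tau> + a..c} \<Longrightarrow> x t = xb t + (t - c) *\<^sub>R q"
      and vel: "\<And>t. t \<in> {t0..t1} - F \<Longrightarrow> velocity t0 t1 x t = ?v t +
        (if t \<in> {\<tau>..\<tau> + a} then p else if t \<in> {\<tau> + a..c} then q else 0)"
      by (rule sawtooth_variation[OF KC1 \<tau>'(1) ab \<open>c < t1\<close>[unfolded c_def] apbq, folded c_def]) (rule that)
    have k1: "norm ((t - \<tau>) *\<^sub>R p) < r" if "t \<in> {\<tau>..\<tau> + a}" for t
    proof -
      have "norm ((t - \<tau>) *\<^sub>R p) \<le> (a + b) * norm p"
        using that ab by (simp add: mult_right_mono)
      then show ?thesis using small by linarith
    qed
    have k2: "norm ((t - c) *\<^sub>R q) < r" if "t \<in> {\<tau> + a..c}" for t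
    proof -
      have "norm ((t - c) *\<^sub>R q) \<le> (a + b) * norm q"
        using that ab by (simp add: mult_right_mono c_def)
      then show ?thesis using small by linarith
    qed
    have "C_norm t0 t1 (\<lambda>t. x t - xb t) \<le> ereal d"
      unfolding C_norm_def
    proof (rule SUP_least)
      fix t
      have "norm (x t - xb t) \<le> r"
      proof (cases "t \<in> {\<tau>..c}")
        case True
        show ?thesis
        proof (cases "t \<le> \<tau> + a")
          case True
          then show ?thesis using \<open>t \<in> {\<tau>..c}\<close> on1[of t] k1[of t] by simp
        next
          case False
          then show ?thesis using \<open>t \<in> {\<tau>..c}\<close> on2[of t] k2[of t] by simp
        qed
      qed (use off r(1) in auto)
      then show "ereal (norm (x t - xb t)) \<le> ereal d" using r(4) by simp
    qed
    moreover have "Linf_norm t0 t1 (\<lambda>t. velocity t0 t1 x t - ?v t) \<le> ereal (max (norm p) (norm q))"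
      using vel by (intro Linf_norm_le[OF \<open>finite F\<close>, where
          g = "\<lambda>t. if t \<in> {\<tau>..\<tau> + a} then p else if t \<in> {\<tau> + a..c} then q else 0"]) (auto simp: le_max_iff_disj)
    ultimately have J: "J L t0 t1 xb \<le> J L t0 t1 x"
      using min adm ends by simp
    define g where "g t = L t (x t) (velocity t0 t1 x t) - L t (xb t) (?v t)" for t
    have int: "(\<lambda>t. L t (xb t) (?v t)) integrable_on {t0..t1}"
      "(\<lambda>t. L t (x t) (velocity t0 t1 x t)) integrable_on {t0..t1}"
      using KC1_Lagrangian_integrable[OF assms(1) _ assms(2) L_cont] KC1 adm
      by (auto simp: admissible_def)
    then have g_int: "g integrable_on {t0..t1}"
      unfolding g_def by (intro integrable_diff)
    have "integral {t0..t1} g = J L t0 t1 x - J L t0 t1 xb"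
      unfolding g_def J_def using int by (intro integral_diff)
    then have "0 \<le> integral {t0..t1} g" using J by simp
    also have "integral {t0..t1} g
        = integral {t0..\<tau>} g + integral {\<tau>..\<tau> + a} g + integral {\<tau> + a..c} g + integral {c..t1} g"
    proof -
      have "integral {t0..t1} g = integral {t0..\<tau>} g + integral {\<tau>..t1} g"
        using \<tau>' \<open>c < t1\<close> ab g_int unfolding c_def
        by (intro Henstock_Kurzweil_Integration.integral_combine[symmetric]) auto
      moreover have "g integrable_on {\<tau>..t1}" "g integrable_on {\<tau> + a..t1}"
        using integrable_on_subinterval[OF g_int] \<tau>' ab by auto
      moreover from this have "integral {\<tau>..t1} g = integral {\<tau>..\<tau> + a} g + integral {\<tau> + a..t1} g"
        "integral {\<tau> + a..t1} g = integral {\<tau> + a..c} g + integral {c..t1} g"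
        using \<open>c < t1\<close> ab unfolding c_def
        by (auto intro!: Henstock_Kurzweil_Integration.integral_combine[symmetric])
      ultimately show ?thesis by simp
    qed
    \<comment> \<open>Off the support \<open>x\<close> and \<open>xb\<close> agree, and outside
      \<open>F\<close> so do their velocities. The end knot joins the negligible set because
      \<open>vel\<close> counts it to the sawtooth; the same is done at \<open>c\<close>.\<close>
    also have "integral {t0..\<tau>} g = 0"
      using integral_spike[of "insert \<tau> F" "{t0..\<tau>}" "\<lambda>_. 0" g] \<open>finite F\<close> off vel \<tau>' \<open>c < t1\<close> ab
      by (simp add: negligible_finite g_def c_def)
    also have "integral {c..t1} g = 0"
      using integral_spike[of "insert c F" "{c..t1}" "\<lambda>_. 0" g] \<open>finite F\<close> off vel \<tau>' \<open>c < t1\<close> ab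
      by (simp add: negligible_finite g_def c_def)
    finally have "0 \<le> integral {\<tau>..\<tau> + a} g + integral {\<tau> + a..c} g" by simp
    also have "integral {\<tau>..\<tau> + a} g \<le> (\<tau> + a - \<tau>) * (l (\<tau> + a) \<bullet> p) - (\<tau> - \<tau>) * (l \<tau> \<bullet> p)
        + (?\<Delta> p \<bullet> p + e * norm p) * ((\<tau> + a - \<tau>)\<^sup>2 - (\<tau> - \<tau>)\<^sup>2) / 2"
    proof (rule integral_le_total_derivative[OF _ \<open>finite F\<close>, where l' = l'])
      have sub: "{\<tau>..\<tau> + a} \<subseteq> {s0<..<s1}" using \<tau> small(1) r(5) ab by auto
      show "(l has_vector_derivative l' t) (at t within {\<tau>..\<tau> + a})" if "t \<in> {\<tau>..\<tau> + a}" for t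
        using that sub by (intro Euler) auto
      show "(g has_integral integral {\<tau>..\<tau> + a} g) {\<tau>..\<tau> + a}"
        using integrable_on_subinterval[OF g_int] sub s(1) by (blast intro: integrable_integral)
      show "g t \<le> l t \<bullet> p + (t - \<tau>) * (l' t \<bullet> p) + (?\<Delta> p \<bullet> p + e * norm p) * (t - \<tau>)"
        if t: "t \<in> {\<tau>..\<tau> + a} - F" for t
      proof -
        have ts: "t \<in> {s0<..<s1}" "\<bar>t - \<tau>\<bar> < r1" using t sub small(1) ab r by auto
        then have "t \<in> D" using s(1) assms(2) by auto
        have "L t (xb t + (t - \<tau>) *\<^sub>R p) (?v t + p) - L t (xb t) (?v t + p)
            \<le> (l' t + ?\<Delta> p) \<bullet> ((t - \<tau>) *\<^sub>R p) + e * norm ((t - \<tau>) *\<^sub>R p)"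
        proof (rule increment_le_gradient_bound)
          show "GDERIV (\<lambda>y. L t y (?v t + p)) y :> L_x L t y (?v t + p)" for y
            by (rule L_x_continuously_differentiable(1)[OF C1 \<open>t \<in> D\<close>])
          show "norm (L_x L t (xb t + y) (?v t + p) - (l' t + ?\<Delta> p)) \<le> e"
            if "norm y \<le> norm ((t - \<tau>) *\<^sub>R p)" for y
            using r1(2) ts that k1[of t] t r(2) by fastforce
        qed
        \<comment> \<open>Degeneracy enters here: the expansion in the velocity is exact although
          \<open>p\<close> is not small.\<close>
        moreover have "L t (xb t) (?v t + p) = L t (xb t) (?v t) + l t \<bullet> p"
          using E(1)[OF ts(1)] by (simp add: Weierstrass_E_def l_def)
        moreover have "g t = L t (xb t + (t - \<tau>) *\<^sub>R p) (?v t + p) - L t (xb t) (?v t)"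
          using on1[of t] vel[of t] t ts(1) s(1) unfolding g_def by auto
        moreover have "(l' t + ?\<Delta> p) \<bullet> ((t - \<tau>) *\<^sub>R p) + e * norm ((t - \<tau>) *\<^sub>R p)
            = (t - \<tau>) * (l' t \<bullet> p) + (?\<Delta> p \<bullet> p + e * norm p) * (t - \<tau>)"
          using t by (simp add: inner_add_left ring_distribs)
        ultimately show ?thesis by linarith
      qed
    qed (use ab in auto)
    also have "integral {\<tau> + a..c} g \<le> (c - c) * (l c \<bullet> q) - (\<tau> + a - c) * (l (\<tau> + a) \<bullet> q)
        + (?\<Delta> q \<bullet> q - e * norm q) * ((c - c)\<^sup>2 - (\<tau> + a - c)\<^sup>2) / 2"
    \<comment> \<open>At the middle knot the case distinction in \<open>vel\<close> selects
      \<open>p\<close>, so this point is added to the exceptional set.\<close>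
    proof (rule integral_le_total_derivative[where F = "insert (\<tau> + a) F" and l' = l'])
      have sub: "{\<tau> + a..c} \<subseteq> {s0<..<s1}" using \<tau> small(1) r(5) ab by (auto simp: c_def)
      show "(l has_vector_derivative l' t) (at t within {\<tau> + a..c})" if "t \<in> {\<tau> + a..c}" for t
        using that sub by (intro Euler) auto
      show "(g has_integral integral {\<tau> + a..c} g) {\<tau> + a..c}"
        using integrable_on_subinterval[OF g_int] sub s(1) by (blast intro: integrable_integral)
      show "g t \<le> l t \<bullet> q + (t - c) * (l' t \<bullet> q) + (?\<Delta> q \<bullet> q - e * norm q) * (t - c)"
        if t: "t \<in> {\<tau> + a..c} - insert (\<tau> + a) F" for t
      proof -
        have ts: "t \<in> {s0<..<s1}" "\<bar>t - \<tau>\<bar> < r2" using t sub small(1) ab r by (auto simp: c_def)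
        then have "t \<in> D" using s(1) assms(2) by auto
        have "L t (xb t + (t - c) *\<^sub>R q) (?v t + q) - L t (xb t) (?v t + q)
            \<le> (l' t + ?\<Delta> q) \<bullet> ((t - c) *\<^sub>R q) + e * norm ((t - c) *\<^sub>R q)"
        proof (rule increment_le_gradient_bound)
          show "GDERIV (\<lambda>y. L t y (?v t + q)) y :> L_x L t y (?v t + q)" for y
            by (rule L_x_continuously_differentiable(1)[OF C1 \<open>t \<in> D\<close>])
          show "norm (L_x L t (xb t + y) (?v t + q) - (l' t + ?\<Delta> q)) \<le> e"
            if "norm y \<le> norm ((t - c) *\<^sub>R q)" for y
            using r2(2) ts that k2[of t] t r(3) by fastforce
        qed
        moreover have "L t (xb t) (?v t + q) = L t (xb t) (?v t) + l t \<bullet> q"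
          using E(2)[OF ts(1)] by (simp add: Weierstrass_E_def l_def)
        moreover have "g t = L t (xb t + (t - c) *\<^sub>R q) (?v t + q) - L t (xb t) (?v t)"
          using on2[of t] vel[of t] t ts(1) s(1) unfolding g_def by auto
        \<comment> \<open>On this edge \<open>t - c\<close> is at most 0, so the norm contributes
          \<open>- (t - c) * norm q\<close>; this is why \<open>e\<close> carries a minus sign in
          \<kappa>.\<close>
        moreover have "(l' t + ?\<Delta> q) \<bullet> ((t - c) *\<^sub>R q) + e * norm ((t - c) *\<^sub>R q)
            = (t - c) * (l' t \<bullet> q) + (?\<Delta> q \<bullet> q - e * norm q) * (t - c)"
          using t by (simp add: inner_add_left ring_distribs)
        ultimately show ?thesis by linarith
      qed
    qed (use ab \<open>finite F\<close> in \<open>auto simp: c_def\<close>)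
    \<comment> \<open>The boundary terms at \<tau> and \<open>c\<close> vanish with the sawtooth.
      Those at the middle knot combine, since \<open>\<tau> + a - c = - b\<close>, to a multiple of
      the closing condition \<open>apbq\<close>.\<close>
    finally have "0 \<le> l (\<tau> + a) \<bullet> (a *\<^sub>R p + b *\<^sub>R q)
        + (a\<^sup>2 * (?\<Delta> p \<bullet> p + e * norm p) - b\<^sup>2 * (?\<Delta> q \<bullet> q - e * norm q)) / 2"
      by (simp add: c_def inner_add_right algebra_simps diff_divide_distrib add_divide_distrib)
    then have "0 \<le> \<epsilon>\<^sup>2 * (\<alpha>\<^sup>2 * (?\<Delta> p \<bullet> p + e * norm p) - \<beta>\<^sup>2 * (?\<Delta> q \<bullet> q - e * norm q))"
      unfolding apbq by (simp add: a_def b_def power_mult_distrib algebra_simps)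
    then show ?thesis using \<epsilon>(1) by (simp add: zero_le_mult_iff)
  qed
  show ?thesis
  proof (rule field_le_epsilon)
    fix e' :: real assume "0 < e'"
    \<comment> \<open>\<open>N\<close> is the total coefficient of \<open>e\<close> in
      \<open>key\<close>. Dividing by \<open>N + 1\<close> gives \<open>e * N \<le> e'\<close> and
      stays defined when \<open>N\<close> is 0.\<close>
    define N where "N = \<alpha>\<^sup>2 * norm p + \<beta>\<^sup>2 * norm q"
    have "0 \<le> N" by (simp add: N_def)
    define e where "e = e' / (N + 1)"
    have "0 < e" using \<open>0 < e'\<close> \<open>0 \<le> N\<close> by (simp add: e_def)
    then have "0 \<le> \<alpha>\<^sup>2 * (?\<Delta> p \<bullet> p) - \<beta>\<^sup>2 * (?\<Delta> q \<bullet> q) + e * N"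
      using key[of e] by (simp add: N_def algebra_simps)
    moreover have "e * N \<le> e'"
      using \<open>0 < e'\<close> \<open>0 \<le> N\<close> by (simp add: e_def field_simps)
    ultimately show "\<beta>\<^sup>2 * (?\<Delta> q \<bullet> q) \<le> \<alpha>\<^sup>2 * (?\<Delta> p \<bullet> p) + e'" by linarith
  qed
qed


section \<open>From two inequalities to equality (C)\<close>

text \<open>The conjugate vector is the slope that closes the sawtooth when the two edges have
  durations proportional to \<open>lam\<close> and \<open>1 - lam\<close>.\<close>

lemma conj_vec_balance:
  assumes "lam \<in> {0<..<1}"
  shows "lam *\<^sub>R \<eta> + (1 - lam) *\<^sub>R conj_vec lam \<eta> = 0"
proof -
  have "(1 - lam) * (inverse (lam - 1) * lam) = - lam"
    using assms by (simp add: field_simps)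
  then show ?thesis by (simp add: conj_vec_def)
qed

text \<open>The two orders of the slopes give opposite inequalities between quadratic expressions in
  \<open>\<eta>\<close> and \<open>conj_vec lam \<eta>\<close>. In the resulting equality the
  balance relation replaces \<open>(1 - lam) *\<^sub>R conj_vec lam \<eta>\<close> by
  \<open>- (lam *\<^sub>R \<eta>)\<close>, which leaves \<open>lam\<close> times (C).\<close>

lemma degenerate_imp_equality_C:
  fixes L :: "'n::finite integrand" and xb :: "real \<Rightarrow> real^'n"
  assumes "t0 < t1" "{t0..t1} \<subseteq> D"
    and "continuously_differentiable_on (\<lambda>(t, x, v). L t x v) (D \<times> UNIV \<times> UNIV)"
    and "extremal L t0 t1 x0 x1 xb"
    and "{s0<..<s1} \<subseteq> {t0..t1}" "{s0<..<s1} \<inter> angular_points t0 t1 xb = {}"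
    and lam: "lam \<in> {0<..<1}" and deg: "degenerate L t0 t1 xb s0 s1 \<eta> lam"
    and "0 < d"
    and min: "\<And>x. admissible t0 t1 x0 x1 x \<Longrightarrow> C_norm t0 t1 (\<lambda>t. x t - xb t) \<le> ereal d \<Longrightarrow>
      Linf_norm t0 t1 (\<lambda>t. velocity t0 t1 x t - velocity t0 t1 xb t)
        \<le> ereal (max (norm \<eta>) (norm (conj_vec lam \<eta>))) \<Longrightarrow>
      J L t0 t1 xb \<le> J L t0 t1 x"
  shows "equality_C L t0 t1 xb s0 s1 \<eta> lam"
  unfolding equality_C_def
proof
  fix \<tau> assume \<tau>: "\<tau> \<in> {s0<..<s1}"
  let ?\<mu> = "conj_vec lam \<eta>" and ?\<Delta> = "Delta_L_x L t0 t1 xb \<tau>"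
  note ineq = degenerate_imp_inequality[OF assms(1-6) \<tau>, where d = d, OF _ _ _ _ _ \<open>0 < d\<close>]
  have E: "Weierstrass_E L t0 t1 xb t \<eta> = 0" "Weierstrass_E L t0 t1 xb t ?\<mu> = 0"
    if "t \<in> {s0<..<s1}" for t
    using deg that by (auto simp: degenerate_def)
  have bal: "lam *\<^sub>R \<eta> + (1 - lam) *\<^sub>R ?\<mu> = 0" by (rule conj_vec_balance[OF lam])
  have "(1 - lam)\<^sup>2 * (?\<Delta> ?\<mu> \<bullet> ?\<mu>) \<le> lam\<^sup>2 * (?\<Delta> \<eta> \<bullet> \<eta>)"
    using lam bal E min by (intro ineq) auto
  \<comment> \<open>The same lemma with slopes and durations interchanged; the closing condition and
    the norm bound in \<open>min\<close> are symmetric.\<close>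
  moreover have "lam\<^sup>2 * (?\<Delta> \<eta> \<bullet> \<eta>) \<le> (1 - lam)\<^sup>2 * (?\<Delta> ?\<mu> \<bullet> ?\<mu>)"
    using lam bal E min by (intro ineq) (auto simp: add.commute max.commute)
  ultimately have "lam\<^sup>2 * (?\<Delta> \<eta> \<bullet> \<eta>) = (1 - lam) * (?\<Delta> ?\<mu> \<bullet> ((1 - lam) *\<^sub>R ?\<mu>))"
    by (simp add: power2_eq_square)
  also have "(1 - lam) *\<^sub>R ?\<mu> = - (lam *\<^sub>R \<eta>)"
    using bal by (simp add: eq_neg_iff_add_eq_0 add.commute)
  finally have "lam * (lam * (?\<Delta> \<eta> \<bullet> \<eta>) + (1 - lam) * (?\<Delta> ?\<mu> \<bullet> \<eta>)) = 0"
    by (simp add: power2_eq_square algebra_simps)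
  then show "lam * (?\<Delta> \<eta> \<bullet> \<eta>) + (1 - lam) * (?\<Delta> ?\<mu> \<bullet> \<eta>) = 0"
    using lam by simp
qed

theorem theorem4p1:
  fixes L :: "real \<Rightarrow> real^'n::finite \<Rightarrow> real^'n \<Rightarrow> real"
    and a b :: ereal
    and t0 t1 s0 s1 :: real
    and x0 x1 :: "real^'n"
    and xb :: "real \<Rightarrow> real^'n"
  assumes "t0 < t1"
    and "{t0..t1} \<subseteq> einterval a b"
    and "continuously_differentiable_on (\<lambda>(t, x, v). L t x v) (einterval a b \<times> UNIV \<times> UNIV)"
    and "extremal L t0 t1 x0 x1 xb"
    and "s0 < s1"
    and "{s0<..<s1} \<subseteq> {t0..t1}"
    and "{s0<..<s1} \<inter> angular_points t0 t1 xb = {}"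
  shows "(strong_local_min L t0 t1 x0 x1 xb \<longrightarrow>
            (\<forall>\<eta> lam. \<eta> \<noteq> 0 \<and> lam \<in> {0<..<1} \<and> degenerate L t0 t1 xb s0 s1 \<eta> lam
               \<longrightarrow> equality_C L t0 t1 xb s0 s1 \<eta> lam)) \<and>
         (weak_local_min L t0 t1 x0 x1 xb \<longrightarrow>
            (\<exists>\<delta>::real. \<delta> > 0 \<and>
              (\<forall>\<eta> lam. (\<eta>, conj_vec lam \<eta>, lam) \<in> cball 0 \<delta> \<times> cball 0 \<delta> \<times> {0<..<1} \<and>
                 degenerate L t0 t1 xb s0 s1 \<eta> lam
                 \<longrightarrow> equality_C L t0 t1 xb s0 s1 \<eta> lam)))"
proof (intro conjI impI)
  note C = degenerate_imp_equality_C[OF assms(1-4,6,7)]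
  show "\<forall>\<eta> lam. \<eta> \<noteq> 0 \<and> lam \<in> {0<..<1} \<and> degenerate L t0 t1 xb s0 s1 \<eta> lam
      \<longrightarrow> equality_C L t0 t1 xb s0 s1 \<eta> lam" if strong: "strong_local_min L t0 t1 x0 x1 xb"
  proof (intro allI impI)
    fix \<eta> :: "real^'n" and lam :: real
    assume H: "\<eta> \<noteq> 0 \<and> lam \<in> {0<..<1} \<and> degenerate L t0 t1 xb s0 s1 \<eta> lam"
    obtain d where d: "0 < d" "\<And>x. admissible t0 t1 x0 x1 x \<Longrightarrow>
        C_norm t0 t1 (\<lambda>t. x t - xb t) \<le> ereal d \<Longrightarrow> J L t0 t1 xb \<le> J L t0 t1 x"
      using strong unfolding strong_local_min_def by blast
    show "equality_C L t0 t1 xb s0 s1 \<eta> lam"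
      using H d(2) by (intro C[OF _ _ d(1)]) auto
  qed
  assume "weak_local_min L t0 t1 x0 x1 xb"
  then obtain d where d: "0 < d" "\<And>x. admissible t0 t1 x0 x1 x \<Longrightarrow>
      max (C_norm t0 t1 (\<lambda>t. x t - xb t))
        (Linf_norm t0 t1 (\<lambda>t. velocity t0 t1 x t - velocity t0 t1 xb t)) \<le> ereal d \<Longrightarrow>
      J L t0 t1 xb \<le> J L t0 t1 x"
    unfolding weak_local_min_def by blast
  \<comment> \<open>The radius of the weak neighbourhood itself serves as \<delta>: with both slopes
    in the ball of radius \<open>d\<close>, the velocity difference also stays within
    \<open>d\<close>.\<close>
  have "equality_C L t0 t1 xb s0 s1 \<eta> lam"
    if H: "(\<eta>, conj_vec lam \<eta>, lam) \<in> cball 0 d \<times> cball 0 d \<times> {0<..<1}"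
      "degenerate L t0 t1 xb s0 s1 \<eta> lam" for \<eta> lam
  proof (rule C[OF _ H(2) d(1)])
    have "ereal (max (norm \<eta>) (norm (conj_vec lam \<eta>))) \<le> ereal d" using H(1) by simp
    then show "J L t0 t1 xb \<le> J L t0 t1 x"
      if "admissible t0 t1 x0 x1 x" "C_norm t0 t1 (\<lambda>t. x t - xb t) \<le> ereal d"
        "Linf_norm t0 t1 (\<lambda>t. velocity t0 t1 x t - velocity t0 t1 xb t)
          \<le> ereal (max (norm \<eta>) (norm (conj_vec lam \<eta>)))" for x
      using that by (intro d(2)) (auto intro: order_trans)
  qed (use H(1) in auto)
  then show "\<exists>\<delta>::real. \<delta> > 0 \<and>
      (\<forall>\<eta> lam. (\<eta>, conj_vec lam \<eta>, lam) \<in> cball 0 \<delta> \<times> cball 0 \<delta> \<times> {0<..<1} \<and>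
         degenerate L t0 t1 xb s0 s1 \<eta> lam \<longrightarrow> equality_C L t0 t1 xb s0 s1 \<eta> lam)"
    using d(1) by blast
qed

end
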